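(* Let $d\ge1$, let $M$ be a $d\times d$ integer matrix with all eigenvalues of modulus $>1$, and let $P$ be a $d\times d$ integer matrix with $p:=|\det P|\neq0$ that is an admissible oversampling matrix for $M$. Then every $g\in H$ can be written uniquely as $$g=\sum_{r=0}^{p-1}\mathbf{T}'_{P\theta_r}S'f_r$$ for some $f_0,\dots,f_{p-1}\in L^2(\mathbb{R}^d)$.
   Context: $P$ is admissible for $M$ if $PMP^{-1}$ has integer entries and $M^{-1}\mathbb{Z}^d\cap P^{-1}\mathbb{Z}^d=\mathbb{Z}^d$. $T_uf(x)=f(x-u)$. Let $\{\theta_r:0\le r\le p-1\}$ be a complete set of representatives of $P^{-1}\mathbb{Z}^d/\mathbb{Z}^d$ with $\theta_0=0$ (so $P\theta_r\in\mathbb{Z}^d$), and $\{\theta^*_q:0\le q\le p-1\}$ a complete set of representatives of $(P^* )^{-1}\mathbb{Z}^d/\mathbb{Z}^d$ with $\theta^*_0=0$ ($P^*$ the transpose). $H=L^2(\mathbb{R}^d)^{\oplus p}$ with elements $(f_q)_{0\le q\le p-1}$. For $k\in\mathbb{Z}^d$, $\mathbf{T}'_k(f_q)_q=(e^{2\pi ik\cdot\theta^*_q}T_kf_q)_q$. For $f\in L^2(\mathbb{R}^d)$, $S'f=\frac1p\big(f(P^{-1}\cdot),\dots,f(P^{-1}\cdot)\big)\in H$ (an isometry). *)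

theory Defs
  imports "HOL-Analysis.Analysis"
begin

text \<open>The integer lattice Z^d inside R^d (vectors indexed by the finite type 'd).\<close>
definition Zd :: "(real ^ 'd) set" where
  "Zd = {x. \<forall>i. x $ i \<in> \<int>}"

definition int_mat :: "real ^ 'd ^ 'd \<Rightarrow> bool" where
  "int_mat A \<longleftrightarrow> (\<forall>i j. A $ i $ j \<in> \<int>)"

text \<open>Complexification of a real matrix.\<close>
definition cmat :: "real ^ 'd ^ 'd \<Rightarrow> complex ^ 'd ^ 'd" where
  "cmat A = (\<chi> i j. complex_of_real (A $ i $ j))"

text \<open>All (complex) eigenvalues of M have modulus > 1.\<close>
definition eigenvalues_gt1 :: "real ^ 'd ^ 'd \<Rightarrow> bool" where
  "eigenvalues_gt1 M \<longleftrightarrow> (\<forall>z::complex. det (mat z - cmat M) = 0 \<longrightarrow> 1 < cmod z)"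

text \<open>P admissible for M: P M P^{-1} integer and M^{-1}Z^d \<inter> P^{-1}Z^d = Z^d
  (preimages, M and P being invertible).\<close>
definition admissible :: "real ^ 'd ^ 'd \<Rightarrow> real ^ 'd ^ 'd \<Rightarrow> bool" where
  "admissible P M \<longleftrightarrow> int_mat (P ** M ** matrix_inv P) \<and>
     {x. M *v x \<in> Zd} \<inter> {x. P *v x \<in> Zd} = Zd"

text \<open>theta_0,...,theta_{p-1} is a complete set of representatives of A/Z^d with theta_0 = 0.\<close>
definition complete_reps :: "(real ^ 'd) set \<Rightarrow> nat \<Rightarrow> (nat \<Rightarrow> real ^ 'd) \<Rightarrow> bool" where
  "complete_reps A p \<theta> \<longleftrightarrow> \<theta> 0 = 0 \<and> (\<forall>r<p. \<theta> r \<in> A) \<and>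
     (\<forall>x\<in>A. \<exists>!r. r < p \<and> x - \<theta> r \<in> Zd)"

text \<open>Membership in L^2(R^d) (complex valued, Lebesgue measure).\<close>
definition L2 :: "(real ^ 'd \<Rightarrow> complex) \<Rightarrow> bool" where
  "L2 f \<longleftrightarrow> f \<in> borel_measurable lebesgue \<and> integrable lebesgue (\<lambda>x. (cmod (f x))\<^sup>2)"

text \<open>Elements of H = L^2(R^d)^p, represented as families indexed by q < p.\<close>
definition inH :: "nat \<Rightarrow> (nat \<Rightarrow> real ^ 'd \<Rightarrow> complex) \<Rightarrow> bool" where
  "inH p g \<longleftrightarrow> (\<forall>q<p. L2 (g q))"

text \<open>Equality in H (almost everywhere in each component).\<close>
definition Heq :: "nat \<Rightarrow> (nat \<Rightarrow> real ^ 'd \<Rightarrow> complex) \<Rightarrow> (nat \<Rightarrow> real ^ 'd \<Rightarrow> complex) \<Rightarrow> bool" where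
  "Heq p g h \<longleftrightarrow> (\<forall>q<p. AE x in lebesgue. g q x = h q x)"

definition transl :: "real ^ 'd \<Rightarrow> (real ^ 'd \<Rightarrow> complex) \<Rightarrow> real ^ 'd \<Rightarrow> complex" where
  "transl u f = (\<lambda>x. f (x - u))"

text \<open>T'_k (f_q)_q = (e^{2 pi i k.theta*_q} T_k f_q)_q.\<close>
definition Tprime :: "(nat \<Rightarrow> real ^ 'd) \<Rightarrow> real ^ 'd \<Rightarrow> (nat \<Rightarrow> real ^ 'd \<Rightarrow> complex)
    \<Rightarrow> (nat \<Rightarrow> real ^ 'd \<Rightarrow> complex)" where
  "Tprime \<theta>s k g = (\<lambda>q x. exp (2 * pi * \<i> * complex_of_real (k \<bullet> \<theta>s q)) * transl k (g q) x)"

text \<open>S'f = (1/p)(f(P^{-1} .), ..., f(P^{-1} .)).\<close>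
definition Sprime :: "real ^ 'd ^ 'd \<Rightarrow> nat \<Rightarrow> (real ^ 'd \<Rightarrow> complex) \<Rightarrow> (nat \<Rightarrow> real ^ 'd \<Rightarrow> complex)" where
  "Sprime P p f = (\<lambda>q x. (1 / of_nat p) * f (matrix_inv P *v x))"

text \<open>The synthesis map (f_r)_r \<mapsto> sum_{r<p} T'_{P theta_r} S' f_r.\<close>
definition synth :: "real ^ 'd ^ 'd \<Rightarrow> nat \<Rightarrow> (nat \<Rightarrow> real ^ 'd) \<Rightarrow> (nat \<Rightarrow> real ^ 'd)
    \<Rightarrow> (nat \<Rightarrow> real ^ 'd \<Rightarrow> complex) \<Rightarrow> (nat \<Rightarrow> real ^ 'd \<Rightarrow> complex)" where
  "synth P p \<theta> \<theta>s f = (\<lambda>q x. \<Sum>r<p. Tprime \<theta>s (P *v \<theta> r) (Sprime P p (f r)) q x)"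

end

(*
  Written out, the q-th component of the synthesis at x is
  (1/p) \<Sum>\<^sub>r e(P\<theta>\<^sub>r \<bullet> \<theta>*\<^sub>q) f\<^sub>r(P\<^sup>-\<^sup>1(x - P\<theta>\<^sub>r)) with e(t) = exp(2\<pi>it).
  Orthogonality of the characters of the dual finite groups P\<^sup>-\<^sup>1\<int>\<^sup>d/\<int>\<^sup>d and
  (P\<^sup>T)\<^sup>-\<^sup>1\<int>\<^sup>d/\<int>\<^sup>d makes the p \<times> p matrix (e(P\<theta>\<^sub>r \<bullet> \<theta>*\<^sub>q)) equal to \<surd>p times a
  unitary matrix, so for every x the system can be solved uniquely for the values
  f\<^sub>r(P\<^sup>-\<^sup>1(x - P\<theta>\<^sub>r)).  This determines each f\<^sub>r everywhere, resp. almost everywhere,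
  and f\<^sub>r is square integrable because an invertible affine map multiplies Lebesgue
  measure by a constant.
*)
theory Submission
  imports Defs
begin

section \<open>Lebesgue measure under invertible affine maps\<close>

lemma measure_swap_coordinates_cbox:
  "measure lebesgue ((\<lambda>x::real^'n. \<chi> i. x $ Transposition.transpose m n i) ` cbox a b)
     = measure lebesgue (cbox a b)"
proof (cases "cbox a b = {}")
  case False
  let ?h = "\<lambda>x::real^'n. \<chi> i. x $ Transposition.transpose m n i"
  have "?h ` cbox a b = cbox (?h a) (?h b)"
    by (auto simp: image_iff lambda_swap_Galois mem_box_cart) (metis transpose_involutory)+
  moreover have "?h ` cbox a b \<noteq> {}"
    using False by blast
  ultimately show ?thesis
    using False prod.permute [OF permutes_swap_id, where S=UNIV and g="\<lambda>i. (b - a)$i", symmetric]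
    by (simp add: content_cbox_cart)
qed simp

lemma measure_shear_cbox:
  fixes a b :: "real^'n"
  assumes "m \<noteq> n"
  shows "measure lebesgue ((\<lambda>x. \<chi> i. if i = m then x$m + x$n else x$i) ` cbox a b)
           = measure lebesgue (cbox a b)"
proof (cases "cbox a b = {}")
  case False
  let ?h = "\<lambda>x::real^'n. \<chi> i. if i = m then x$m + x$n else x$i"
  define v :: "real^'n" where "v = (\<chi> i. if i = n then - a$n else 0)"
  \<comment> \<open>\<open>measure_shear_interval\<close> needs \<open>0 \<le> a$n\<close>, hence the translation by \<open>v\<close>\<close>
  have "cbox a b = (+) (- v) ` cbox (v + a) (v + b)"
    using cbox_translation [of "- v" "v + a" "v + b"] by simp
  then have "?h ` cbox a b = (+) (?h (- v)) ` ?h ` cbox (v + a) (v + b)"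
    by (simp only: image_image) (intro image_cong refl; simp add: vec_eq_iff)
  then have "measure lebesgue (?h ` cbox a b) = measure lebesgue (?h ` cbox (v + a) (v + b))"
    by (simp add: measure_translation)
  also have "\<dots> = measure lebesgue (cbox (v + a) (v + b))"
  proof (rule measure_shear_interval [OF assms])
    show "cbox (v + a) (v + b) \<noteq> {}"
      using False by (simp add: cbox_translation)
  qed (simp add: v_def)
  also have "\<dots> = measure lebesgue (cbox a b)"
    by (simp only: cbox_translation measure_translation)
  finally show ?thesis .
qed simp

text \<open>Change_Of_Vars proves this with \<open>c = \<bar>det (matrix f)\<bar>\<close>, but only for index types
  of class \<open>wellorder\<close>; here the value of the constant is irrelevant.\<close>
lemma lmeasurable_linear_image_scale:
  fixes f :: "real^'n \<Rightarrow> real^'n"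
  assumes "linear f"
  shows "\<exists>c\<ge>0. \<forall>S\<in>lmeasurable. f ` S \<in> lmeasurable \<and> measure lebesgue (f ` S) = c * measure lebesgue S"
    (is "?scales f")
proof -
  have volume_preserving: "?scales h"
    if "linear h" and boxes: "\<And>a b. measure lebesgue (h ` cbox a b) = measure lebesgue (cbox a b)" for h
  proof (intro exI [of _ 1] conjI ballI)
    fix S :: "(real^'n) set"
    assume "S \<in> lmeasurable"
    with measure_linear_sufficient [OF \<open>linear h\<close>, of S 1] boxes
    show "h ` S \<in> lmeasurable" "measure lebesgue (h ` S) = 1 * measure lebesgue S"
      by simp_all
  qed simp
  show ?thesis
  proof (rule induct_linear_elementary [OF assms])
    fix f g :: "real^'n \<Rightarrow> real^'n"
    assume "?scales f" "?scales g"
    then obtain a b where "a \<ge> 0" "b \<ge> 0"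
      and f: "\<forall>S\<in>lmeasurable. f ` S \<in> lmeasurable \<and> measure lebesgue (f ` S) = a * measure lebesgue S"
      and g: "\<forall>S\<in>lmeasurable. g ` S \<in> lmeasurable \<and> measure lebesgue (g ` S) = b * measure lebesgue S"
      by blast
    show "?scales (f \<circ> g)"
    proof (intro exI [of _ "a * b"] conjI ballI)
      fix S :: "(real^'n) set"
      assume "S \<in> lmeasurable"
      with g have gS: "g ` S \<in> lmeasurable" "measure lebesgue (g ` S) = b * measure lebesgue S"
        by blast+
      with f have "f ` g ` S \<in> lmeasurable" "measure lebesgue (f ` g ` S) = a * (b * measure lebesgue S)"
        by simp_all
      then show "(f \<circ> g) ` S \<in> lmeasurable"
        "measure lebesgue ((f \<circ> g) ` S) = a * b * measure lebesgue S"
        unfolding image_comp [symmetric] mult.assoc .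
    qed (use \<open>a \<ge> 0\<close> \<open>b \<ge> 0\<close> in simp)
  next
    fix f :: "real^'n \<Rightarrow> real^'n" and i
    assume "linear f" and "\<And>x. f x $ i = 0"
    then have "\<not> inj f"
      by (metis (full_types) linear_injective_imp_surjective one_neq_zero surjE vec_component)
    then have "negligible (f ` S)" for S
      using \<open>linear f\<close> negligible_linear_singular_image by blast
    then show "?scales f"
      by (intro exI [of _ 0]) (simp add: negligible_imp_measure0 negligible_imp_measurable)
  next
    fix c :: "'n \<Rightarrow> real"
    show "?scales (\<lambda>x. \<chi> i. c i * x $ i)"
      by (intro exI [of _ "\<bar>prod c UNIV\<bar>"]) (auto simp: measurable_stretch measure_stretch)
  next
    fix m n :: 'n
    show "?scales (\<lambda>x. \<chi> i. x $ Transposition.transpose m n i)"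
    proof (rule volume_preserving)
      show "linear (\<lambda>x. \<chi> i. x $ Transposition.transpose m n i)"
        by (rule linearI) (simp_all add: plus_vec_def scaleR_vec_def)
    qed (rule measure_swap_coordinates_cbox)
  next
    fix m n :: 'n
    assume "m \<noteq> n"
    show "?scales (\<lambda>x. \<chi> i. if i = m then x $ m + x $ n else x $ i)"
    proof (rule volume_preserving)
      show "linear (\<lambda>x. \<chi> i. if i = m then x $ m + x $ n else x $ i)"
        by (rule linearI) (auto simp: algebra_simps plus_vec_def scaleR_vec_def vec_eq_iff)
    qed (rule measure_shear_cbox [OF \<open>m \<noteq> n\<close>])
  qed
qed

lemma emeasure_linear_image_scale:
  fixes f :: "real^'n \<Rightarrow> real^'n"
  assumes "linear f"
  shows "\<exists>c\<ge>0. \<forall>S\<in>sets lebesgue.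
           f ` S \<in> sets lebesgue \<and> emeasure lebesgue (f ` S) = ennreal c * emeasure lebesgue S"
proof -
  obtain c where "c \<ge> 0"
    and c: "\<And>S. S \<in> lmeasurable \<Longrightarrow> f ` S \<in> lmeasurable \<and> measure lebesgue (f ` S) = c * measure lebesgue S"
    using lmeasurable_linear_image_scale [OF assms] by blast
  have "f ` S \<in> sets lebesgue \<and> emeasure lebesgue (f ` S) = ennreal c * emeasure lebesgue S"
    if S: "S \<in> sets lebesgue" for S
  proof -
    define B where "B n = S \<inter> cball 0 (real n)" for n
    have B: "B n \<in> lmeasurable" for n
      unfolding B_def by (intro bounded_set_imp_lmeasurable) (auto simp: S bounded_Int)
    have "incseq B"
      unfolding B_def incseq_def by auto
    then have "incseq (\<lambda>n. f ` B n)"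
      by (auto simp: incseq_def image_mono)
    have S_eq: "S = (\<Union>n. B n)"
      unfolding B_def by (auto simp: real_arch_simple)
    show ?thesis
    proof
      show "f ` S \<in> sets lebesgue"
        using B c unfolding S_eq image_UN by (auto simp: fmeasurable_def)
      have "emeasure lebesgue (f ` S) = (SUP n. emeasure lebesgue (f ` B n))"
        unfolding S_eq image_UN using B c \<open>incseq (\<lambda>n. f ` B n)\<close>
        by (intro SUP_emeasure_incseq [symmetric]) (auto simp: fmeasurable_def)
      also have "\<dots> = (SUP n. ennreal c * emeasure lebesgue (B n))"
        using B c \<open>c \<ge> 0\<close> by (simp add: emeasure_eq_measure2 ennreal_mult)
      also have "\<dots> = ennreal c * emeasure lebesgue S"
        unfolding S_eq SUP_mult_left_ennreal [symmetric] using B \<open>incseq B\<close>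
        by (subst SUP_emeasure_incseq) (auto simp: fmeasurable_def)
      finally show "emeasure lebesgue (f ` S) = ennreal c * emeasure lebesgue S" .
    qed
  qed
  with \<open>c \<ge> 0\<close> show ?thesis
    by blast
qed

lemma matrix_inv_inverse:
  fixes A :: "'a::semiring_1^'n^'m"
  assumes "invertible A"
  shows "A ** matrix_inv A = mat 1" "matrix_inv A ** A = mat 1"
  using someI_ex [OF assms [unfolded invertible_def]] unfolding matrix_inv_def by auto

lemma lebesgue_affine_vimage:
  fixes L :: "real^'n^'n"
  assumes "invertible L"
  shows "\<exists>c\<ge>0. \<forall>A\<in>sets lebesgue. (\<lambda>y. L *v y + t) -` A \<in> sets lebesgue \<and>
           emeasure lebesgue ((\<lambda>y. L *v y + t) -` A) = ennreal c * emeasure lebesgue A"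
proof -
  let ?L' = "matrix_inv L"
  obtain c where "c \<ge> 0" and c: "\<And>S. S \<in> sets lebesgue \<Longrightarrow>
      (*v) ?L' ` S \<in> sets lebesgue \<and> emeasure lebesgue ((*v) ?L' ` S) = ennreal c * emeasure lebesgue S"
    using emeasure_linear_image_scale [of "(*v) ?L'"] by auto
  have vimage_eq: "(\<lambda>y. L *v y + t) -` A = (*v) ?L' ` (\<lambda>x. x + - t) ` A" for A
  proof (intro set_eqI iffI)
    fix y
    assume "y \<in> (\<lambda>y. L *v y + t) -` A"
    moreover have "y = ?L' *v (L *v y + t + - t)"
      by (simp add: matrix_vector_mul_assoc matrix_inv_inverse [OF assms])
    ultimately show "y \<in> (*v) ?L' ` (\<lambda>x. x + - t) ` A"
      by blast
  qed (auto simp: matrix_vector_mul_assoc matrix_inv_inverse [OF assms])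
  have translate: "(\<lambda>x. x + - t) ` A \<in> sets lebesgue"
    and "emeasure lebesgue ((\<lambda>x. x + - t) ` A) = emeasure lebesgue A" if "A \<in> sets lebesgue" for A
    using lebesgue_sets_translation [OF that, of "- t"] emeasure_lebesgue_affine [of 1 "- t" A]
    by (simp_all add: add.commute)
  with c \<open>c \<ge> 0\<close> show ?thesis
    unfolding vimage_eq by (metis translate)
qed

lemma measurable_lebesgue_affine:
  fixes L :: "real^'n^'n"
  assumes "invertible L"
  shows "(\<lambda>y. L *v y + t) \<in> lebesgue \<rightarrow>\<^sub>M lebesgue"
  using lebesgue_affine_vimage [OF assms, of t] by (intro measurableI) auto

lemma AE_lebesgue_affine:
  fixes L :: "real^'n^'n"
  assumes "invertible L" and "AE x in lebesgue. Q x"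
  shows "AE y in lebesgue. Q (L *v y + t)"
proof -
  obtain N where N: "{x. \<not> Q x} \<subseteq> N" "N \<in> null_sets lebesgue"
    using assms(2) unfolding eventually_ae_filter by auto
  moreover obtain c where "(\<lambda>y. L *v y + t) -` N \<in> sets lebesgue"
    "emeasure lebesgue ((\<lambda>y. L *v y + t) -` N) = ennreal c * emeasure lebesgue N"
    using lebesgue_affine_vimage [OF assms(1), of t] N(2) by blast
  ultimately have "(\<lambda>y. L *v y + t) -` N \<in> null_sets lebesgue"
    by (metis null_setsD1 null_setsI mult_zero_right)
  then show ?thesis
    by (rule AE_I') (use N in auto)
qed

lemma integrable_lebesgue_affine:
  fixes L :: "real^'n^'n" and \<phi> :: "real^'n \<Rightarrow> 'b::{banach, second_countable_topology}"
  assumes "invertible L" and "integrable lebesgue \<phi>"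
  shows "integrable lebesgue (\<lambda>y. \<phi> (L *v y + t))"
proof -
  let ?T = "\<lambda>y. L *v y + t"
  obtain c where "c \<ge> 0" and c: "\<And>A. A \<in> sets lebesgue \<Longrightarrow>
      ?T -` A \<in> sets lebesgue \<and> emeasure lebesgue (?T -` A) = ennreal c * emeasure lebesgue A"
    using lebesgue_affine_vimage [OF assms(1), of t] by blast
  have T: "?T \<in> lebesgue \<rightarrow>\<^sub>M lebesgue"
    by (rule measurable_lebesgue_affine [OF assms(1)])
  have "distr lebesgue lebesgue ?T = density lebesgue (\<lambda>_. ennreal c)"
  proof (rule measure_eqI)
    fix A
    assume "A \<in> sets (distr lebesgue lebesgue ?T)"
    then have A: "A \<in> sets lebesgue"
      by simp
    have "emeasure (distr lebesgue lebesgue ?T) A = emeasure lebesgue (?T -` A)"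
      using emeasure_distr [OF T A] by simp
    also have "\<dots> = ennreal c * emeasure lebesgue A"
      using c [OF A] by blast
    also have "\<dots> = emeasure (density lebesgue (\<lambda>_. ennreal c)) A"
      using A by (simp add: emeasure_density nn_integral_cmult_indicator)
    finally show "emeasure (distr lebesgue lebesgue ?T) A = emeasure (density lebesgue (\<lambda>_. ennreal c)) A" .
  qed simp
  moreover have "integrable (density lebesgue (\<lambda>_. ennreal c)) \<phi>"
    using assms(2) \<open>c \<ge> 0\<close> by (subst integrable_density) auto
  ultimately show ?thesis
    using integrable_distr_eq [OF T borel_measurable_integrable [OF assms(2)]] by simp
qed

section \<open>Square integrable functions\<close>

lemma norm_add_power2_le:
  fixes a b :: "'a::real_normed_vector"
  shows "(norm (a + b))\<^sup>2 \<le> 2 * (norm a)\<^sup>2 + 2 * (norm b)\<^sup>2"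
proof -
  have "(norm (a + b))\<^sup>2 \<le> (norm a + norm b)\<^sup>2"
    by (simp add: norm_triangle_ineq power_mono)
  also have "\<dots> \<le> 2 * (norm a)\<^sup>2 + 2 * (norm b)\<^sup>2"
    using sum_squares_ge_zero [of "norm a - norm b" 0] by (simp add: power2_eq_square algebra_simps)
  finally show ?thesis .
qed

lemma L2_add:
  assumes "L2 f" and "L2 g"
  shows "L2 (\<lambda>x. f x + g x)"
proof -
  have "integrable lebesgue (\<lambda>x. (cmod (f x + g x))\<^sup>2)"
  proof (rule Bochner_Integration.integrable_bound)
    show "integrable lebesgue (\<lambda>x. 2 * (cmod (f x))\<^sup>2 + 2 * (cmod (g x))\<^sup>2)"
      using assms unfolding L2_def by auto
    have "f \<in> borel_measurable lebesgue" "g \<in> borel_measurable lebesgue"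
      using assms unfolding L2_def by auto
    then show "(\<lambda>x. (cmod (f x + g x))\<^sup>2) \<in> borel_measurable lebesgue"
      by measurable
  qed (simp add: norm_add_power2_le)
  with assms show ?thesis
    unfolding L2_def by auto
qed

lemma L2_mult_left: "L2 f \<Longrightarrow> L2 (\<lambda>x. c * f x)"
  unfolding L2_def by (auto simp: norm_mult power_mult_distrib)

lemma L2_sum:
  assumes "finite I" and "\<And>i. i \<in> I \<Longrightarrow> L2 (f i)"
  shows "L2 (\<lambda>x. \<Sum>i\<in>I. f i x)"
  using assms by (induction I rule: finite_induct) (auto simp: L2_add, simp add: L2_def)

lemma L2_affine:
  fixes L :: "real^'n^'n"
  assumes "invertible L" and "L2 f"
  shows "L2 (\<lambda>y. f (L *v y + t))"
  using assms measurable_compose [OF measurable_lebesgue_affine [OF assms(1)]]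
    integrable_lebesgue_affine [OF assms(1)]
  unfolding L2_def by auto

section \<open>Characters of finite lattice quotients\<close>

definition e2pi :: "real \<Rightarrow> complex" where
  "e2pi t = exp (2 * pi * \<i> * complex_of_real t)"

lemma e2pi_add: "e2pi (a + b) = e2pi a * e2pi b"
  unfolding e2pi_def by (simp add: distrib_left exp_add)

lemma cnj_e2pi: "cnj (e2pi a) = e2pi (- a)"
  unfolding e2pi_def by (simp add: exp_cnj)

lemma e2pi_eq_1_iff: "e2pi t = 1 \<longleftrightarrow> t \<in> \<int>"
proof
  assume "e2pi t = 1"
  then obtain n :: int where "Im (2 * pi * \<i> * complex_of_real t) = of_int (2 * n) * pi"
    unfolding e2pi_def exp_eq_1 by blast
  then have "t = of_int n"
    by simp
  then show "t \<in> \<int>"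
    by simp
next
  assume "t \<in> \<int>"
  then obtain k where "t = of_int k"
    using Ints_cases by blast
  then show "e2pi t = 1"
    unfolding e2pi_def exp_eq_1 by (intro conjI exI [of _ k]) simp_all
qed

lemma e2pi_eqI: "a - b \<in> \<int> \<Longrightarrow> e2pi a = e2pi b"
  using e2pi_add [of "a - b" b] e2pi_eq_1_iff by simp

lemma zero_in_Zd: "0 \<in> Zd"
  by (simp add: Zd_def)

lemma add_in_Zd: "x \<in> Zd \<Longrightarrow> y \<in> Zd \<Longrightarrow> x + y \<in> Zd"
  by (auto simp: Zd_def)

lemma diff_in_Zd: "x \<in> Zd \<Longrightarrow> y \<in> Zd \<Longrightarrow> x - y \<in> Zd"
  by (auto simp: Zd_def)

lemma axis_in_Zd: "axis i 1 \<in> Zd"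
  by (auto simp: Zd_def axis_def)

lemma inner_Zd_Ints: "x \<in> Zd \<Longrightarrow> y \<in> Zd \<Longrightarrow> x \<bullet> y \<in> \<int>"
  unfolding Zd_def inner_vec_def by (auto intro!: Ints_sum Ints_mult)

lemma complete_reps_diff_in_Zd_iff:
  assumes "complete_reps A p \<theta>" and "r < p" and "s < p"
  shows "\<theta> r - \<theta> s \<in> Zd \<longleftrightarrow> r = s"
proof
  have "\<exists>!u. u < p \<and> \<theta> r - \<theta> u \<in> Zd"
    using assms(1,2) unfolding complete_reps_def by blast
  moreover have "\<theta> r - \<theta> r \<in> Zd"
    by (simp add: zero_in_Zd)
  ultimately show "\<theta> r - \<theta> s \<in> Zd \<Longrightarrow> r = s"
    using assms(2,3) by blast
qed (simp add: zero_in_Zd)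

lemma complete_reps_translate:
  assumes reps: "complete_reps A p \<theta>" and closed: "\<And>x. x \<in> A \<Longrightarrow> x + a \<in> A"
  obtains \<sigma> where "bij_betw \<sigma> {..<p} {..<p}" and "\<And>r. r < p \<Longrightarrow> \<theta> r + a - \<theta> (\<sigma> r) \<in> Zd"
proof -
  define \<sigma> where "\<sigma> r = (THE s. s < p \<and> \<theta> r + a - \<theta> s \<in> Zd)" for r
  have \<sigma>: "\<sigma> r < p \<and> \<theta> r + a - \<theta> (\<sigma> r) \<in> Zd" if "r < p" for r
  proof -
    have "\<theta> r + a \<in> A"
      using reps that closed by (auto simp: complete_reps_def)
    then have "\<exists>!s. s < p \<and> \<theta> r + a - \<theta> s \<in> Zd"
      using reps unfolding complete_reps_def by blast
    then show ?thesis
      unfolding \<sigma>_def by (rule theI')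
  qed
  have "inj_on \<sigma> {..<p}"
  proof (rule inj_onI)
    fix r s
    assume "r \<in> {..<p}" "s \<in> {..<p}" "\<sigma> r = \<sigma> s"
    then have "(\<theta> r + a - \<theta> (\<sigma> r)) - (\<theta> s + a - \<theta> (\<sigma> s)) \<in> Zd"
      using \<sigma> by (blast intro: diff_in_Zd)
    moreover have "(\<theta> r + a - \<theta> (\<sigma> r)) - (\<theta> s + a - \<theta> (\<sigma> s)) = \<theta> r - \<theta> s"
      using \<open>\<sigma> r = \<sigma> s\<close> by (simp add: algebra_simps)
    ultimately have "\<theta> r - \<theta> s \<in> Zd"
      by simp
    with reps \<open>r \<in> {..<p}\<close> \<open>s \<in> {..<p}\<close> show "r = s"
      by (simp add: complete_reps_diff_in_Zd_iff)
  qed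
  moreover have "\<sigma> ` {..<p} = {..<p}"
    by (rule endo_inj_surj) (use \<sigma> \<open>inj_on \<sigma> {..<p}\<close> in auto)
  ultimately show ?thesis
    using that \<sigma> unfolding bij_betw_def by blast
qed

lemma inner_matrix_vector_transpose: "(A *v x) \<bullet> y = x \<bullet> (transpose A *v (y :: real^'n))"
  using dot_lmul_matrix [of x "transpose A" y] by simp

lemma e2pi_inner_Zd_periodic:
  assumes "transpose Q *v \<eta> \<in> Zd" and "x - y \<in> Zd"
  shows "e2pi ((Q *v x) \<bullet> \<eta>) = e2pi ((Q *v y) \<bullet> \<eta>)"
proof (rule e2pi_eqI)
  have "(Q *v x) \<bullet> \<eta> - (Q *v y) \<bullet> \<eta> = (x - y) \<bullet> (transpose Q *v \<eta>)"
    by (simp add: inner_matrix_vector_transpose inner_diff_left)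
  then show "(Q *v x) \<bullet> \<eta> - (Q *v y) \<bullet> \<eta> \<in> \<int>"
    using inner_Zd_Ints [OF assms(2,1)] by simp
qed

text \<open>Orthogonality of the characters \<open>x \<mapsto> e2pi (x \<bullet> \<eta>)\<close> of the finite group
  \<open>Q\<^sup>-\<^sup>1\<int>\<^sup>d/\<int>\<^sup>d\<close>: the sum is invariant under translation by \<open>Q\<^sup>-\<^sup>1 e\<^sub>i\<close>, which multiplies
  it by \<open>e2pi (\<eta> $ i)\<close>.\<close>
lemma sum_e2pi_complete_reps:
  fixes Q :: "real^'n^'n"
  assumes "invertible Q" and reps: "complete_reps {x. Q *v x \<in> Zd} p \<theta>"
    and dual: "transpose Q *v \<eta> \<in> Zd"
  shows "(\<Sum>r<p. e2pi ((Q *v \<theta> r) \<bullet> \<eta>)) = (if \<eta> \<in> Zd then of_nat p else 0)"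
proof (cases "\<eta> \<in> Zd")
  case True
  have "e2pi ((Q *v \<theta> r) \<bullet> \<eta>) = 1" if "r < p" for r
    using reps that True by (auto simp: complete_reps_def e2pi_eq_1_iff intro: inner_Zd_Ints)
  with True show ?thesis
    by simp
next
  case False
  then obtain i where i: "\<eta> $ i \<notin> \<int>"
    unfolding Zd_def by auto
  define a where "a = matrix_inv Q *v axis i 1"
  have Qa: "Q *v a = axis i 1"
    unfolding a_def by (simp add: matrix_vector_mul_assoc matrix_inv_inverse [OF assms(1)])
  have "Q *v (x + a) \<in> Zd" if "Q *v x \<in> Zd" for x
    using that by (simp add: matrix_vector_right_distrib Qa add_in_Zd axis_in_Zd)
  then obtain \<sigma> where \<sigma>: "bij_betw \<sigma> {..<p} {..<p}" "\<And>r. r < p \<Longrightarrow> \<theta> r + a - \<theta> (\<sigma> r) \<in> Zd"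
    using complete_reps_translate [OF reps, of a] by blast
  define S where "S = (\<Sum>r<p. e2pi ((Q *v \<theta> r) \<bullet> \<eta>))"
  have "S = (\<Sum>r<p. e2pi ((Q *v \<theta> (\<sigma> r)) \<bullet> \<eta>))"
    unfolding S_def by (rule sum.reindex_bij_betw [OF \<sigma>(1), symmetric])
  also have "\<dots> = (\<Sum>r<p. e2pi ((Q *v (\<theta> r + a)) \<bullet> \<eta>))"
  proof (rule sum.cong [OF refl])
    fix r
    assume "r \<in> {..<p}"
    then show "e2pi ((Q *v \<theta> (\<sigma> r)) \<bullet> \<eta>) = e2pi ((Q *v (\<theta> r + a)) \<bullet> \<eta>)"
      by (intro e2pi_inner_Zd_periodic [OF dual, symmetric] \<sigma>(2)) simp
  qed
  also have "\<dots> = (\<Sum>r<p. e2pi ((Q *v \<theta> r) \<bullet> \<eta>) * e2pi (\<eta> $ i))"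
    by (simp only: matrix_vector_right_distrib inner_add_left e2pi_add Qa inner_axis' inner_real_def mult_1_left)
  also have "\<dots> = S * e2pi (\<eta> $ i)"
    unfolding S_def by (rule sum_distrib_right [symmetric])
  finally have "S * (e2pi (\<eta> $ i) - 1) = 0"
    by (simp add: right_diff_distrib)
  moreover have "e2pi (\<eta> $ i) \<noteq> 1"
    using i by (simp add: e2pi_eq_1_iff)
  ultimately show ?thesis
    using False unfolding S_def by simp
qed

section \<open>Inverting the synthesis map\<close>

lemma scaled_unitary_solve_iff:
  fixes A :: "nat \<Rightarrow> nat \<Rightarrow> complex"
  assumes rows: "\<And>q q'. q < n \<Longrightarrow> q' < n \<Longrightarrow>
      (\<Sum>r<n. A q r * cnj (A q' r)) = (if q = q' then of_nat n else 0)"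
    and cols: "\<And>r r'. r < n \<Longrightarrow> r' < n \<Longrightarrow>
      (\<Sum>q<n. cnj (A q r') * A q r) = (if r = r' then of_nat n else 0)"
  shows "(\<forall>q<n. (\<Sum>r<n. A q r * u r) / of_nat n = v q) \<longleftrightarrow>
         (\<forall>r<n. u r = (\<Sum>q<n. cnj (A q r) * v q))"
proof
  assume v: "\<forall>q<n. (\<Sum>r<n. A q r * u r) / of_nat n = v q"
  show "\<forall>r<n. u r = (\<Sum>q<n. cnj (A q r) * v q)"
  proof (intro allI impI)
    fix r
    assume "r < n"
    have "(\<Sum>q<n. cnj (A q r) * v q) = (\<Sum>q<n. cnj (A q r) * ((\<Sum>r'<n. A q r' * u r') / of_nat n))"
      using v by simp
    also have "\<dots> = (\<Sum>q<n. \<Sum>r'<n. cnj (A q r) * A q r' * u r') / of_nat n"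
      by (simp add: sum_divide_distrib sum_distrib_left mult.assoc)
    also have "\<dots> = (\<Sum>r'<n. (\<Sum>q<n. cnj (A q r) * A q r') * u r') / of_nat n"
      by (subst sum.swap) (simp add: sum_distrib_right)
    also have "\<dots> = u r"
      using \<open>r < n\<close> by (simp add: cols if_distrib [of "\<lambda>z. z * _"] eq_commute [of r] cong: if_cong)
    finally show "u r = (\<Sum>q<n. cnj (A q r) * v q)" ..
  qed
next
  assume u: "\<forall>r<n. u r = (\<Sum>q<n. cnj (A q r) * v q)"
  show "\<forall>q<n. (\<Sum>r<n. A q r * u r) / of_nat n = v q"
  proof (intro allI impI)
    fix q
    assume "q < n"
    have "(\<Sum>r<n. A q r * u r) = (\<Sum>r<n. \<Sum>q'<n. A q r * cnj (A q' r) * v q')"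
      using u by (simp add: sum_distrib_left mult.assoc)
    also have "\<dots> = (\<Sum>q'<n. (\<Sum>r<n. A q r * cnj (A q' r)) * v q')"
      by (subst sum.swap) (simp add: sum_distrib_right)
    also have "\<dots> = of_nat n * v q"
      using \<open>q < n\<close> by (simp add: rows if_distrib [of "\<lambda>z. z * _"] cong: if_cong)
    finally show "(\<Sum>r<n. A q r * u r) / of_nat n = v q"
      using \<open>q < n\<close> by simp
  qed
qed

definition synth_coeff ::
    "real^'d^'d \<Rightarrow> (nat \<Rightarrow> real^'d) \<Rightarrow> (nat \<Rightarrow> real^'d) \<Rightarrow> nat \<Rightarrow> nat \<Rightarrow> complex"
  where "synth_coeff P \<theta> \<theta>s q r = e2pi ((P *v \<theta> r) \<bullet> \<theta>s q)"

lemma synth_altdef: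
  "synth P p \<theta> \<theta>s f q x =
     (\<Sum>r<p. synth_coeff P \<theta> \<theta>s q r * f r (matrix_inv P *v (x - P *v \<theta> r))) / of_nat p"
  unfolding synth_def Tprime_def Sprime_def transl_def synth_coeff_def e2pi_def
  by (simp add: sum_divide_distrib)

definition synth_inverse ::
    "real^'d^'d \<Rightarrow> nat \<Rightarrow> (nat \<Rightarrow> real^'d) \<Rightarrow> (nat \<Rightarrow> real^'d) \<Rightarrow>
     (nat \<Rightarrow> real^'d \<Rightarrow> complex) \<Rightarrow> nat \<Rightarrow> real^'d \<Rightarrow> complex"
  where "synth_inverse P p \<theta> \<theta>s g r y = (\<Sum>q<p. cnj (synth_coeff P \<theta> \<theta>s q r) * g q (P *v y + P *v \<theta> r))"

lemma L2_synth_inverse: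
  assumes "invertible P" and "inH p g"
  shows "L2 (synth_inverse P p \<theta> \<theta>s g r)"
  unfolding synth_inverse_def
proof (intro L2_sum L2_mult_left L2_affine [OF assms(1)])
  show "L2 (g q)" if "q \<in> {..<p}" for q
    using assms(2) that by (simp add: inH_def)
qed simp

context
  fixes P :: "real^'d^'d" and p :: nat and \<theta> \<theta>s :: "nat \<Rightarrow> real^'d"
  assumes P: "invertible P"
    and reps: "complete_reps {x. P *v x \<in> Zd} p \<theta>"
    and dual_reps: "complete_reps {x. transpose P *v x \<in> Zd} p \<theta>s"
begin

lemma synth_coeff_rows_orthogonal:
  assumes "q < p" and "q' < p"
  shows "(\<Sum>r<p. synth_coeff P \<theta> \<theta>s q r * cnj (synth_coeff P \<theta> \<theta>s q' r)) = (if q = q' then of_nat p else 0)"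
proof -
  have "transpose P *v (\<theta>s q - \<theta>s q') \<in> Zd"
    using dual_reps assms by (auto simp: complete_reps_def matrix_vector_mult_diff_distrib intro: diff_in_Zd)
  then have "(\<Sum>r<p. e2pi ((P *v \<theta> r) \<bullet> (\<theta>s q - \<theta>s q'))) = (if q = q' then of_nat p else 0)"
    using sum_e2pi_complete_reps [OF P reps] complete_reps_diff_in_Zd_iff [OF dual_reps assms] by simp
  then show ?thesis
    by (simp add: synth_coeff_def cnj_e2pi e2pi_add [symmetric] inner_diff_right)
qed

lemma synth_coeff_columns_orthogonal:
  assumes "r < p" and "r' < p"
  shows "(\<Sum>q<p. cnj (synth_coeff P \<theta> \<theta>s q r') * synth_coeff P \<theta> \<theta>s q r) = (if r = r' then of_nat p else 0)"
proof -
  have "invertible (transpose P)"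
    using P by (simp add: invertible_det_nz det_transpose)
  moreover have "transpose (transpose P) *v (\<theta> r - \<theta> r') \<in> Zd"
    using reps assms by (auto simp: complete_reps_def matrix_vector_mult_diff_distrib intro: diff_in_Zd)
  ultimately have "(\<Sum>q<p. e2pi ((transpose P *v \<theta>s q) \<bullet> (\<theta> r - \<theta> r'))) = (if r = r' then of_nat p else 0)"
    using sum_e2pi_complete_reps [OF _ dual_reps] complete_reps_diff_in_Zd_iff [OF reps assms] by simp
  moreover have "(transpose P *v \<theta>s q) \<bullet> (\<theta> r - \<theta> r') = (P *v \<theta> r) \<bullet> \<theta>s q - (P *v \<theta> r') \<bullet> \<theta>s q" for q
  proof -
    have "(transpose P *v \<theta>s q) \<bullet> (\<theta> r - \<theta> r') = (P *v (\<theta> r - \<theta> r')) \<bullet> \<theta>s q"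
      by (metis inner_commute inner_matrix_vector_transpose)
    then show ?thesis
      by (simp only: matrix_vector_mult_diff_distrib inner_diff_left)
  qed
  ultimately show ?thesis
    by (simp add: synth_coeff_def cnj_e2pi e2pi_add [symmetric])
qed

lemma synth_eq_iff:
  "(\<forall>q<p. synth P p \<theta> \<theta>s f q x = g q x) \<longleftrightarrow>
   (\<forall>r<p. f r (matrix_inv P *v (x - P *v \<theta> r)) = (\<Sum>q<p. cnj (synth_coeff P \<theta> \<theta>s q r) * g q x))"
  unfolding synth_altdef
  by (rule scaled_unitary_solve_iff [OF synth_coeff_rows_orthogonal synth_coeff_columns_orthogonal])

lemma synth_synth_inverse:
  assumes "q < p"
  shows "synth P p \<theta> \<theta>s (synth_inverse P p \<theta> \<theta>s g) q x = g q x"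
proof -
  have "P *v (matrix_inv P *v (x - P *v \<theta> r)) + P *v \<theta> r = x" for r
    by (simp add: matrix_vector_mul_assoc matrix_inv_inverse [OF P])
  then have "\<forall>r<p. synth_inverse P p \<theta> \<theta>s g r (matrix_inv P *v (x - P *v \<theta> r))
      = (\<Sum>q<p. cnj (synth_coeff P \<theta> \<theta>s q r) * g q x)"
    by (simp add: synth_inverse_def)
  with synth_eq_iff assms show ?thesis
    by blast
qed

lemma AE_synth_inverse_unique:
  assumes "Heq p g (synth P p \<theta> \<theta>s f)" and "r < p"
  shows "AE y in lebesgue. synth_inverse P p \<theta> \<theta>s g r y = f r y"
proof -
  have "AE x in lebesgue. \<forall>q\<in>{..<p}. g q x = synth P p \<theta> \<theta>s f q x"
    using assms(1) unfolding Heq_def by (intro eventually_ball_finite) auto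
  then have "AE x in lebesgue.
      f r (matrix_inv P *v (x - P *v \<theta> r)) = (\<Sum>q<p. cnj (synth_coeff P \<theta> \<theta>s q r) * g q x)"
  proof (rule eventually_mono)
    fix x
    assume "\<forall>q\<in>{..<p}. g q x = synth P p \<theta> \<theta>s f q x"
    then have "\<forall>q<p. synth P p \<theta> \<theta>s f q x = g q x"
      by simp
    with synth_eq_iff \<open>r < p\<close>
    show "f r (matrix_inv P *v (x - P *v \<theta> r)) = (\<Sum>q<p. cnj (synth_coeff P \<theta> \<theta>s q r) * g q x)"
      by blast
  qed
  from AE_lebesgue_affine [OF P this, of "P *v \<theta> r"] show ?thesis
    by (rule eventually_mono) (simp add: synth_inverse_def matrix_vector_mul_assoc matrix_inv_inverse [OF P])
qed

end

theorem lemma4p2: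
  fixes M P :: "real ^ 'd ^ 'd" and p :: nat
    and \<theta> \<theta>s :: "nat \<Rightarrow> real ^ 'd"
  assumes "int_mat M" and "eigenvalues_gt1 M"
    and "int_mat P" and "real p = \<bar>det P\<bar>" and "p \<noteq> 0"
    and "admissible P M"
    and "complete_reps {x. P *v x \<in> Zd} p \<theta>"
    and "complete_reps {x. transpose P *v x \<in> Zd} p \<theta>s"
    and "inH p g"
  shows "\<exists>f. (\<forall>r<p. L2 (f r)) \<and> Heq p g (synth P p \<theta> \<theta>s f) \<and>
           (\<forall>f'. (\<forall>r<p. L2 (f' r)) \<and> Heq p g (synth P p \<theta> \<theta>s f') \<longrightarrow>
                 (\<forall>r<p. AE x in lebesgue. f r x = f' r x))"
proof -
  have P: "invertible P"
    using assms(4,5) by (simp add: invertible_det_nz)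
  let ?f = "synth_inverse P p \<theta> \<theta>s g"
  have "\<forall>r<p. L2 (?f r)"
    using L2_synth_inverse [OF P assms(9)] by blast
  moreover have "Heq p g (synth P p \<theta> \<theta>s ?f)"
    unfolding Heq_def using synth_synth_inverse [OF P assms(7,8)] by simp
  moreover have "\<forall>r<p. AE x in lebesgue. ?f r x = f' r x"
    if "Heq p g (synth P p \<theta> \<theta>s f')" for f'
    using AE_synth_inverse_unique [OF P assms(7,8) that] by blast
  ultimately show ?thesis
    by blast
qed

end
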